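(* Let $\mathcal{S}$ be a subcategory of $\mathbf{Top}$ whose objects are Hausdorff spaces and whose morphisms are injective continuous maps, such that the cardinalities of the objects of $\mathcal{S}$ are not bounded by any natural number. Then there are infinitely many (pairwise distinct) categories geometric over $\mathcal{S}$.
   Context: For a bounded distributive lattice $\mathcal{A}$, an implication over $\mathcal{A}$ is a binary operation $\to$ on $\mathcal{A}$ which is order-reversing in its first argument and order-preserving in its second argument and satisfies $a \to a = 1$ and $(a \to b) \wedge (b \to c) \leq a \to c$. For a space $X$, $\mathcal{O}(X)$ is its locale of opens; a strong space is a pair $(X,\to)$ with $\to$ an implication over $\mathcal{O}(X)$; a strong space map $f:(X,\to_X)\to(Y,\to_Y)$ is a continuous map with $f^{-1}(U \to_Y V) = f^{-1}(U) \to_X f^{-1}(V)$ for all $U,V \in \mathcal{O}(Y)$. For a subcategory $\mathcal{S}$ of $\mathbf{Top}$, a category $\mathcal{C}$ whose objects are strong spaces and whose morphisms are strong space maps is geometric over $\mathcal{S}$ if the forgetful functor $U:\mathcal{C}\to\mathbf{Top}$, $(X,\to_X)\mapsto X$, satisfies: (a) $U$ maps $\mathcal{C}$ into $\mathcal{S}$ and is surjective onto the objects of $\mathcal{S}$; (b) for every object $(Y,\to_Y)$ of $\mathcal{C}$, every object $X$ of $\mathcal{S}$ and every morphism $f: X\to Y$ of $\mathcal{S}$, there is an object $(X,\to_X)$ of $\mathcal{C}$ such that $f:(X,\to_X)\to(Y,\to_Y)$ is a morphism of $\mathcal{C}$. *)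

theory Defs
  imports "HOL-Analysis.Analysis" "HOL-Library.FuncSet"
begin

text \<open>
  Categories of structured sets, with carriers in \<^typ>\<open>'a\<close>.  An arrow is a triple (domain,
  function, codomain).  Functions are required to be extensional, so that equality of arrows, and
  hence of categories, is the mathematical one.
\<close>

record ('o, 'a) concrete_cat =
  Obj :: "'o set"
  Arr :: "('o \<times> ('a \<Rightarrow> 'a) \<times> 'o) set"

definition concrete_category :: "('o \<Rightarrow> 'a set) \<Rightarrow> ('o, 'a) concrete_cat \<Rightarrow> bool" where
  "concrete_category car C \<longleftrightarrow>
     (\<forall>A f B. (A, f, B) \<in> Arr C \<longrightarrow> A \<in> Obj C \<and> B \<in> Obj C \<and> f \<in> car A \<rightarrow>\<^sub>E car B) \<and>
     (\<forall>A\<in>Obj C. (A, restrict id (car A), A) \<in> Arr C) \<and>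
     (\<forall>A f B g D. (A, f, B) \<in> Arr C \<longrightarrow> (B, g, D) \<in> Arr C \<longrightarrow>
        (A, compose (car A) g f, D) \<in> Arr C)"

definition subcategory_of_Top :: "('a topology, 'a) concrete_cat \<Rightarrow> bool" where
  "subcategory_of_Top S \<longleftrightarrow>
     concrete_category topspace S \<and>
     (\<forall>X f Y. (X, f, Y) \<in> Arr S \<longrightarrow> continuous_map X Y f)"

definition opens :: "'a topology \<Rightarrow> 'a set set" where
  "opens X = {U. openin X U}"

text \<open>
  Implications over the lattice of opens, whose order is inclusion, whose meet is intersection and
  whose top is the whole space.  The operation is extensional: it is \<^term>\<open>undefined\<close> at
  arguments that are not open, so an implication is determined by its values on opens.
\<close>

definition implication_over :: "'a topology \<Rightarrow> ('a set \<Rightarrow> 'a set \<Rightarrow> 'a set) \<Rightarrow> bool" where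
  "implication_over X imp \<longleftrightarrow>
     imp \<in> opens X \<rightarrow>\<^sub>E (opens X \<rightarrow>\<^sub>E opens X) \<and>
     (\<forall>a\<in>opens X. \<forall>b\<in>opens X. \<forall>c\<in>opens X. a \<subseteq> b \<longrightarrow> imp b c \<subseteq> imp a c) \<and>
     (\<forall>a\<in>opens X. \<forall>b\<in>opens X. \<forall>c\<in>opens X. b \<subseteq> c \<longrightarrow> imp a b \<subseteq> imp a c) \<and>
     (\<forall>a\<in>opens X. imp a a = topspace X) \<and>
     (\<forall>a\<in>opens X. \<forall>b\<in>opens X. \<forall>c\<in>opens X. imp a b \<inter> imp b c \<subseteq> imp a c)"

type_synonym 'a strong_space = "'a topology \<times> ('a set \<Rightarrow> 'a set \<Rightarrow> 'a set)"

definition strong_space :: "'a strong_space \<Rightarrow> bool" where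
  "strong_space A \<longleftrightarrow> implication_over (fst A) (snd A)"

definition preimage :: "'a topology \<Rightarrow> ('a \<Rightarrow> 'b) \<Rightarrow> 'b set \<Rightarrow> 'a set" where
  "preimage X f U = {x \<in> topspace X. f x \<in> U}"

definition strong_space_map :: "'a strong_space \<Rightarrow> 'a strong_space \<Rightarrow> ('a \<Rightarrow> 'a) \<Rightarrow> bool" where
  "strong_space_map A B f \<longleftrightarrow>
     continuous_map (fst A) (fst B) f \<and>
     (\<forall>U\<in>opens (fst B). \<forall>V\<in>opens (fst B).
        preimage (fst A) f (snd B U V) = snd A (preimage (fst A) f U) (preimage (fst A) f V))"

definition category_of_strong_spaces :: "('a strong_space, 'a) concrete_cat \<Rightarrow> bool" where
  "category_of_strong_spaces C \<longleftrightarrow>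
     concrete_category (\<lambda>A. topspace (fst A)) C \<and>
     (\<forall>A\<in>Obj C. strong_space A) \<and>
     (\<forall>A f B. (A, f, B) \<in> Arr C \<longrightarrow> strong_space_map A B f)"

text \<open>
  The forgetful functor is \<^const>\<open>fst\<close> on objects and sends an arrow (A, f, B) to
  (fst A, f, fst B).
\<close>

definition geometric_over ::
  "('a topology, 'a) concrete_cat \<Rightarrow> ('a strong_space, 'a) concrete_cat \<Rightarrow> bool" where
  "geometric_over S C \<longleftrightarrow>
     category_of_strong_spaces C \<and>
     fst ` Obj C = Obj S \<and>
     (\<forall>A f B. (A, f, B) \<in> Arr C \<longrightarrow> (fst A, f, fst B) \<in> Arr S) \<and>
     (\<forall>Y impY X f. (Y, impY) \<in> Obj C \<longrightarrow> X \<in> Obj S \<longrightarrow> (X, f, Y) \<in> Arr S \<longrightarrow>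
        (\<exists>impX. (X, impX) \<in> Obj C \<and> ((X, impX), f, (Y, impY)) \<in> Arr C))"

end

theory Submission
  imports Defs
begin

text \<open>
  For a finite set \<open>D\<close> of points of a Hausdorff space \<open>X\<close>, the Boolean implication localised at
  \<open>D\<close>, namely \<open>U \<rightarrow> V = X - (D \<inter> (U - V))\<close>, has open values because finite sets are closed.
  It pulls back along an injective continuous map to the implication localised at the preimage of
  \<open>D\<close>, which has at most as many points as \<open>D\<close>.  Hence allowing at most \<open>n\<close> points gives a
  geometric category for every \<open>n\<close>.  These categories differ, since \<open>D\<close> is recovered as
  \<open>X - (X \<rightarrow> {})\<close> and there are spaces with arbitrarily many points.
\<close>

text \<open>At a point of \<open>D\<close> this is classical implication, and at any other point it
  is constantly true. Restricting both arguments to opens supplies the extensionality that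
  \<open>implication_over\<close> demands.\<close>

definition local_imp :: "'a topology \<Rightarrow> 'a set \<Rightarrow> 'a set \<Rightarrow> 'a set \<Rightarrow> 'a set" where
  "local_imp X D = (\<lambda>U\<in>opens X. \<lambda>V\<in>opens X. topspace X - (D \<inter> (U - V)))"

lemma local_imp_apply:
  "U \<in> opens X \<Longrightarrow> V \<in> opens X \<Longrightarrow> local_imp X D U V = topspace X - (D \<inter> (U - V))"
  by (simp add: local_imp_def)

text \<open>Topology enters only through openness of the values: the removed set is finite, hence
  closed in a T1 space. The remaining laws hold pointwise; for the last, a point of \<open>D\<close>
  in \<open>a - c\<close> lies in \<open>a - b\<close> or in \<open>b - c\<close>.\<close>

lemma implication_over_local_imp:
  assumes "t1_space X" "finite D" "D \<subseteq> topspace X"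
  shows "implication_over X (local_imp X D)"
proof -
  have op: "topspace X - (D \<inter> (U - V)) \<in> opens X" for U V
  proof -
    have "closedin X (D \<inter> (U - V))"
      using assms by (meson finite_Int inf.coboundedI1 t1_space_closedin_finite)
    then show ?thesis
      by (simp add: opens_def openin_diff)
  qed
  then have "local_imp X D \<in> opens X \<rightarrow>\<^sub>E (opens X \<rightarrow>\<^sub>E opens X)"
    by (simp add: local_imp_def)
  then show ?thesis
    unfolding implication_over_def by (auto simp: local_imp_apply)
qed

lemma local_imp_inj:
  assumes "D \<subseteq> topspace X" "E \<subseteq> topspace X" "local_imp X D = local_imp X E"
  shows "D = E"
proof -
  have "topspace X \<in> opens X" "{} \<in> opens X"
    by (simp_all add: opens_def)
  then have "topspace X - D = topspace X - E"
    using assms local_imp_apply[of "topspace X" X "{}" D]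
      local_imp_apply[of "topspace X" X "{}" E] by (simp add: Int_absorb2)
  then show ?thesis
    using assms(1,2) by blast
qed

lemma preimage_opens:
  "continuous_map X Y f \<Longrightarrow> U \<in> opens Y \<Longrightarrow> preimage X f U \<in> opens X"
  by (simp add: opens_def preimage_def openin_continuous_map_preimage)

text \<open>Taking preimages commutes with intersection and difference, and the preimage of
  \<open>topspace Y\<close> is \<open>topspace X\<close>.\<close>

lemma strong_space_map_local_imp:
  assumes "continuous_map X Y f"
  shows "strong_space_map (X, local_imp X (preimage X f D)) (Y, local_imp Y D) f"
proof -
  have "f x \<in> topspace Y" if "x \<in> topspace X" for x
    using assms that by (auto dest: continuous_map_funspace)
  then have "preimage X f (topspace Y - (D \<inter> (U - V)))
      = topspace X - (preimage X f D \<inter> (preimage X f U - preimage X f V))" for U V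
    by (auto simp: preimage_def)
  then show ?thesis
    using assms by (simp add: strong_space_map_def local_imp_apply preimage_opens)
qed

lemma strong_space_map_id:
  assumes "strong_space A"
  shows "strong_space_map A A (restrict id (topspace (fst A)))"
proof -
  have "preimage (fst A) (restrict id (topspace (fst A))) U = U" if "U \<in> opens (fst A)" for U
    using openin_subset[of "fst A" U] that by (auto simp: preimage_def opens_def)
  \<comment> \<open>The strong map law also takes the preimage of \<open>snd A U V\<close>; that it
    is fixed by the restricted identity follows once it is known to be open.\<close>
  moreover have "snd A U V \<in> opens (fst A)" if "U \<in> opens (fst A)" "V \<in> opens (fst A)" for U V
  proof -
    have "snd A \<in> opens (fst A) \<rightarrow>\<^sub>E (opens (fst A) \<rightarrow>\<^sub>E opens (fst A))"
      using assms by (simp add: strong_space_def implication_over_def)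
    then show ?thesis
      using that by (meson PiE_mem)
  qed
  moreover have "continuous_map (fst A) (fst A) (restrict id (topspace (fst A)))"
    by (rule continuous_map_eq[OF continuous_map_id]) auto
  ultimately show ?thesis
    by (simp add: strong_space_map_def)
qed

text \<open>The law for \<open>g\<close> is used first; the law for \<open>f\<close> then applies to
  preimages under \<open>g\<close>, which are open by continuity.\<close>

lemma strong_space_map_compose:
  assumes "strong_space B" "strong_space C" "strong_space_map A B f" "strong_space_map B C g"
  shows "strong_space_map A C (compose (topspace (fst A)) g f)"
proof -
  let ?h = "compose (topspace (fst A)) g f"
  have cf: "continuous_map (fst A) (fst B) f" and cg: "continuous_map (fst B) (fst C) g"
    using assms by (simp_all add: strong_space_map_def)
  have "continuous_map (fst A) (fst C) ?h"
    by (rule continuous_map_eq[OF continuous_map_compose[OF cf cg]]) (simp add: compose_def)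
  moreover have "preimage (fst A) ?h U = preimage (fst A) f (preimage (fst B) g U)" for U
    using continuous_map_funspace[OF cf] by (auto simp: preimage_def compose_def)
  ultimately show ?thesis
    using assms(3,4) by (simp add: strong_space_map_def preimage_opens[OF cg])
qed

definition local_cat ::
  "('a topology, 'a) concrete_cat \<Rightarrow> nat \<Rightarrow> ('a strong_space, 'a) concrete_cat" where
  "local_cat S n =
    (let Ob = {(X, local_imp X D) | X D.
           X \<in> Obj S \<and> D \<subseteq> topspace X \<and> finite D \<and> card D \<le> n}
     in \<lparr>Obj = Ob,
         Arr = {(A, f, B). A \<in> Ob \<and> B \<in> Ob \<and> (fst A, f, fst B) \<in> Arr S
           \<and> strong_space_map A B f}\<rparr>)"

lemma Obj_local_cat:
  "Obj (local_cat S n) = {(X, local_imp X D) | X D.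
     X \<in> Obj S \<and> D \<subseteq> topspace X \<and> finite D \<and> card D \<le> n}"
  by (simp add: local_cat_def Let_def)

lemma Arr_local_cat:
  "(A, f, B) \<in> Arr (local_cat S n) \<longleftrightarrow>
     A \<in> Obj (local_cat S n) \<and> B \<in> Obj (local_cat S n) \<and>
     (fst A, f, fst B) \<in> Arr S \<and> strong_space_map A B f"
  by (simp add: local_cat_def Let_def)

lemma category_of_strong_spaces_local_cat:
  assumes S: "concrete_category topspace S"
    and t1: "\<And>X. X \<in> Obj S \<Longrightarrow> t1_space X"
  shows "category_of_strong_spaces (local_cat S n)"
proof -
  have strong: "strong_space A" and base: "fst A \<in> Obj S" if "A \<in> Obj (local_cat S n)" for A
    using that t1 by (auto simp: Obj_local_cat strong_space_def intro!: implication_over_local_imp)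
  have id: "(X, restrict id (topspace X), X) \<in> Arr S" if "X \<in> Obj S" for X
    using S that unfolding concrete_category_def by blast
  have comp: "(X, compose (topspace X) g f, Z) \<in> Arr S"
    if "(X, f, Y) \<in> Arr S" "(Y, g, Z) \<in> Arr S" for X f Y g Z
    using S that unfolding concrete_category_def by blast
  have fn: "f \<in> topspace X \<rightarrow>\<^sub>E topspace Y" if "(X, f, Y) \<in> Arr S" for X f Y
    using S that unfolding concrete_category_def by blast
  have "concrete_category (\<lambda>A. topspace (fst A)) (local_cat S n)"
    unfolding concrete_category_def
  proof (intro conjI allI ballI impI)
    show "(A, compose (topspace (fst A)) g f, D) \<in> Arr (local_cat S n)"
      if "(A, f, B) \<in> Arr (local_cat S n)" "(B, g, D) \<in> Arr (local_cat S n)" for A f B g D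
      using that strong strong_space_map_compose[of B D A f g] comp[of "fst A" f "fst B" g "fst D"]
      by (simp add: Arr_local_cat)
  qed (auto simp: Arr_local_cat base id strong strong_space_map_id dest!: fn)
  then show ?thesis
    using strong by (simp add: category_of_strong_spaces_def Arr_local_cat)
qed

lemma geometric_over_local_cat:
  assumes S: "subcategory_of_Top S"
    and t1: "\<And>X. X \<in> Obj S \<Longrightarrow> t1_space X"
    and inj: "\<And>X f Y. (X, f, Y) \<in> Arr S \<Longrightarrow> inj_on f (topspace X)"
  shows "geometric_over S (local_cat S n)"
  unfolding geometric_over_def
proof (intro conjI allI impI)
  show "category_of_strong_spaces (local_cat S n)"
    using S t1 by (simp add: subcategory_of_Top_def category_of_strong_spaces_local_cat)
  show "fst ` Obj (local_cat S n) = Obj S"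
  proof
    show "Obj S \<subseteq> fst ` Obj (local_cat S n)"
    proof
      fix X assume "X \<in> Obj S"
      \<comment> \<open>The empty set meets every bound, including \<open>n = 0\<close>, so each
        space of \<open>S\<close> underlies some object.\<close>
      then have "(X, local_imp X {}) \<in> Obj (local_cat S n)"
        unfolding Obj_local_cat by fastforce
      then show "X \<in> fst ` Obj (local_cat S n)"
        by force
    qed
  qed (auto simp: Obj_local_cat)
  show "(fst A, f, fst B) \<in> Arr S" if "(A, f, B) \<in> Arr (local_cat S n)" for A f B
    using that by (simp add: Arr_local_cat)
  fix Y impY X f
  assume Y: "(Y, impY) \<in> Obj (local_cat S n)" and X: "X \<in> Obj S" and f: "(X, f, Y) \<in> Arr S"
  obtain D where D: "impY = local_imp Y D" "finite D" "card D \<le> n"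
    using Y by (auto simp: Obj_local_cat)
  let ?D = "preimage X f D"
  \<comment> \<open>Injectivity of \<open>f\<close> embeds \<open>?D\<close> into \<open>D\<close>,
    so finiteness and the bound \<open>n\<close> pass to \<open>?D\<close>.\<close>
  have "inj_on f ?D" "f ` ?D \<subseteq> D" "?D \<subseteq> topspace X"
    using inj[OF f] by (auto simp: preimage_def inj_on_def)
  then have "finite ?D" "card ?D \<le> n"
    using D card_inj_on_le[of f ?D D] by (auto intro: inj_on_finite)
  then have "(X, local_imp X ?D) \<in> Obj (local_cat S n)"
    using X \<open>?D \<subseteq> topspace X\<close> by (auto simp: Obj_local_cat)
  moreover have "strong_space_map (X, local_imp X ?D) (Y, impY) f"
    using S f D(1) by (simp add: subcategory_of_Top_def strong_space_map_local_imp)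
  ultimately show "\<exists>impX. (X, impX) \<in> Obj (local_cat S n) \<and>
      ((X, impX), f, (Y, impY)) \<in> Arr (local_cat S n)"
    using Y f by (auto simp: Arr_local_cat)
qed

text \<open>A large enough space carries an implication localised at exactly \<open>n\<close>
  points. Since the operation determines its set of points, no set of at most \<open>m\<close>
  points yields the same object.\<close>

lemma local_cat_neq:
  assumes unbdd: "\<not> (\<exists>n::nat. \<forall>X\<in>Obj S. finite (topspace X) \<and> card (topspace X) \<le> n)"
    and "m < n"
  shows "local_cat S m \<noteq> local_cat S n"
proof
  assume eq: "local_cat S m = local_cat S n"
  obtain X where X: "X \<in> Obj S" "\<not> (finite (topspace X) \<and> card (topspace X) \<le> n)"
    using unbdd by blast
  \<comment> \<open>The space is either infinite or finite with more than \<open>n\<close> points;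
    both cases provide a subset of size \<open>n\<close>.\<close>
  then have "\<exists>D \<subseteq> topspace X. finite D \<and> card D = n"
    by (metis infinite_arbitrarily_large nat_le_linear obtain_subset_with_card_n)
  then obtain D where D: "D \<subseteq> topspace X" "finite D" "card D = n"
    by blast
  have "(X, local_imp X D) \<in> Obj (local_cat S m)"
    unfolding eq using X D by (auto simp: Obj_local_cat)
  then obtain E where "E \<subseteq> topspace X" "card E \<le> m" "local_imp X D = local_imp X E"
    by (auto simp: Obj_local_cat)
  then show False
    using local_imp_inj[of D X E] D \<open>m < n\<close> by simp
qed

theorem theorem4p8:
  fixes S :: "('a topology, 'a) concrete_cat"
  assumes "subcategory_of_Top S"
    and "\<And>X. X \<in> Obj S \<Longrightarrow> Hausdorff_space X"
    and "\<And>X f Y. (X, f, Y) \<in> Arr S \<Longrightarrow> inj_on f (topspace X)"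
    and "\<not> (\<exists>n::nat. \<forall>X\<in>Obj S. finite (topspace X) \<and> card (topspace X) \<le> n)"
  shows "infinite {C. geometric_over S C}"
proof -
  \<comment> \<open>By linearity of the order on naturals, it suffices to separate indices with
    \<open>m < n\<close>.\<close>
  have "inj (local_cat S)"
    by (rule linorder_injI) (use local_cat_neq[OF assms(4)] in blast)
  moreover have "range (local_cat S) \<subseteq> {C. geometric_over S C}"
    using assms(1-3) by (auto intro!: geometric_over_local_cat Hausdorff_imp_t1_space)
  ultimately show ?thesis
    using infinite_super range_inj_infinite by blast
qed

end
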